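(* Let $G$ be a compact Hausdorff Abelian group, let $G^\wedge$ be its dual group with counting measure $\nu$, let $p$ be a continuous invariant pseudo-metric on $G^\wedge$, and let $\gamma(\xi):=p(\xi,1)$ for $\xi\in G^\wedge$. If the operator $T:L^2(G^\wedge)\to L^2(G^\wedge)$ defined by $$[T(f)](\xi):=\frac{f(\xi)}{\sqrt{1+\gamma(\xi)^2}},\qquad \xi\in G^\wedge,$$ is compact, then $G^\wedge$ is a countable (enumerable) set.
   Context: $G^\wedge$ is the group of continuous homomorphisms $\xi:G\to\mathbb{S}^1$ with identity element $1$ (discrete since $G$ is compact). A pseudo-metric $p$ on $G^\wedge$ is invariant if it is invariant under translations of the group. $L^2(G^\wedge)$ is taken with respect to the counting measure $\nu$. Countable means finite or countably infinite. *)

theory Defs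
  imports "HOL-Analysis.Analysis"
begin

section \<open>The dual group\<close>

typedef (overloaded) 'g dual =
  "{\<xi> :: 'g::topological_ab_group_add \<Rightarrow> complex.
      continuous_on UNIV \<xi> \<and> range \<xi> \<subseteq> sphere 0 1 \<and> (\<forall>x y. \<xi> (x + y) = \<xi> x * \<xi> y)}"
  morphisms char_of Abs_dual
  by (rule exI[of _ "\<lambda>_. 1"]) auto

setup_lifting type_definition_dual

lemma norm_char [simp]: "norm (char_of \<xi> x) = 1"
  using char_of[of \<xi>] by (auto simp: image_subset_iff)

lemma char_nonzero [simp]: "char_of \<xi> x \<noteq> 0"
  using norm_char[of \<xi> x] by force

lemma char_add: "char_of \<xi> (x + y) = char_of \<xi> x * char_of \<xi> y"
  using char_of[of \<xi>] by blast

lemma continuous_on_char: "continuous_on A (char_of \<xi>)"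
  using char_of[of \<xi>] continuous_on_subset by blast

text \<open>The group operations are pointwise. There is no type class of multiplicatively written
  groups, so the group laws are recorded by the interpretation below.\<close>

instantiation dual :: (topological_ab_group_add) "{one, times, inverse}"
begin

lift_definition one_dual :: "'a dual" is "\<lambda>_. 1"
  by auto

lift_definition times_dual :: "'a dual \<Rightarrow> 'a dual \<Rightarrow> 'a dual" is "\<lambda>\<xi> \<eta> x. \<xi> x * \<eta> x"
  by (auto intro!: continuous_intros simp: image_subset_iff norm_mult)

lift_definition inverse_dual :: "'a dual \<Rightarrow> 'a dual" is "\<lambda>\<xi> x. inverse (\<xi> x)"
proof -
  fix \<xi> :: "'a \<Rightarrow> complex"
  assume \<xi>: "continuous_on UNIV \<xi> \<and> range \<xi> \<subseteq> sphere 0 1 \<and> (\<forall>x y. \<xi> (x + y) = \<xi> x * \<xi> y)"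
  then have "norm (\<xi> x) = 1" for x by (auto simp: image_subset_iff)
  then have "\<xi> x \<noteq> 0" for x by (metis norm_zero zero_neq_one)
  with \<xi> show "continuous_on UNIV (\<lambda>x. inverse (\<xi> x)) \<and> range (\<lambda>x. inverse (\<xi> x)) \<subseteq> sphere 0 1 \<and>
      (\<forall>x y. inverse (\<xi> (x + y)) = inverse (\<xi> x) * inverse (\<xi> y))"
    by (auto intro!: continuous_intros simp: image_subset_iff norm_inverse)
qed

definition divide_dual :: "'a dual \<Rightarrow> 'a dual \<Rightarrow> 'a dual"
  where "divide_dual \<xi> \<eta> = \<xi> * inverse \<eta>"

instance ..

end

instance dual :: (topological_ab_group_add) comm_monoid_mult
  by standard (transfer; simp add: fun_eq_iff ac_simps)+

interpretation dual: group "(*)" "1 :: 'g::topological_ab_group_add dual" inverse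
proof
  fix \<xi> :: "'g dual"
  show "inverse \<xi> * \<xi> = 1"
    by (simp add: char_of_inject[symmetric] times_dual.rep_eq inverse_dual.rep_eq
        one_dual.rep_eq fun_eq_iff)
qed (simp_all add: ac_simps)

text \<open>The dual group carries the compact-open topology.\<close>

instantiation dual :: (topological_ab_group_add) topological_space
begin

definition open_dual :: "'a dual set \<Rightarrow> bool" where
  "open_dual = generate_topology {{\<xi>. char_of \<xi> ` K \<subseteq> U} | K U. compact K \<and> open U}"

instance using topological_space_generate_topology
  by intro_classes (auto simp: open_dual_def class.topological_space_def)

end

lemma open_dual_basic: "compact K \<Longrightarrow> open U \<Longrightarrow> open {\<xi>. char_of \<xi> ` K \<subseteq> U}"
  unfolding open_dual_def by (rule generate_topology.Basis) blast

lemma char_near_1: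
  assumes "\<And>x. norm (char_of \<xi> x - 1) < 1"
  shows "\<xi> = 1"
proof -
  have double: "norm (char_of \<xi> (x + x) - 1) \<ge> 3 / 2 * norm (char_of \<xi> x - 1)" for x
  proof -
    have "3 / 2 \<le> norm (char_of \<xi> x + 1)"
    proof -
      let ?z = "char_of \<xi> x"
      have "(norm (?z - 1))\<^sup>2 < 1"
        using assms[of x] by (simp add: abs_square_less_1)
      moreover have "(Re ?z)\<^sup>2 + (Im ?z)\<^sup>2 = 1"
        using norm_char[of \<xi> x] by (metis cmod_power2 one_power2)
      ultimately have "Re ?z > 1 / 2"
        by (simp add: cmod_power2 power2_diff)
      then show ?thesis
        using complex_Re_le_cmod[of "?z + 1"] by simp
    qed
    then have "3 / 2 * norm (char_of \<xi> x - 1) \<le> norm (char_of \<xi> x + 1) * norm (char_of \<xi> x - 1)"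
      by (rule mult_right_mono) simp
    also have "\<dots> = norm (char_of \<xi> (x + x) - 1)"
      by (simp add: char_add norm_mult[symmetric] algebra_simps)
    finally show ?thesis .
  qed
  have "\<exists>y. (3 / 2) ^ n * norm (char_of \<xi> x - 1) \<le> norm (char_of \<xi> y - 1)" for n x
  proof (induction n)
    case (Suc n)
    then obtain y where "(3 / 2) ^ n * norm (char_of \<xi> x - 1) \<le> norm (char_of \<xi> y - 1)"
      by blast
    with double[of y] show ?case
      by (intro exI[of _ "y + y"]) simp
  qed auto
  then have bound: "(3 / 2) ^ n * norm (char_of \<xi> x - 1) < 1" for n x
    using assms by (meson le_less_trans)
  have "char_of \<xi> x = 1" for x
  proof (rule ccontr)
    assume "char_of \<xi> x \<noteq> 1"
    then have "norm (char_of \<xi> x - 1) > 0" by simp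
    moreover obtain n where "1 / norm (char_of \<xi> x - 1) < (3 / 2) ^ n"
      using real_arch_pow[of "3 / 2"] by auto
    ultimately show False
      using bound[of n x] by (simp add: field_simps)
  qed
  then show ?thesis
    by (simp add: char_of_inject[symmetric] one_dual.rep_eq fun_eq_iff)
qed

text \<open>The dual group of a compact group is discrete.\<close>

lemma open_dual_discrete:
  fixes S :: "'g::topological_ab_group_add dual set"
  assumes "compact (UNIV :: 'g set)"
  shows "open S"
proof (subst open_subopen, intro ballI)
  fix \<eta> assume "\<eta> \<in> S"
  define V where "V x = {y. dist (char_of \<eta> x) (char_of \<eta> y) < 1 / 3}" for x
  define K where "K x = {y. dist (char_of \<eta> x) (char_of \<eta> y) \<le> 1 / 3}" for x
  define N where "N x = {\<xi> :: 'g dual. char_of \<xi> ` K x \<subseteq> ball (char_of \<eta> x) (2 / 3)}" for x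
  have "open (V x)" for x
    unfolding V_def by (intro open_Collect_less continuous_intros continuous_on_char)
  moreover have "UNIV \<subseteq> (\<Union>x\<in>UNIV. V x)"
    by (auto simp: V_def)
  ultimately obtain F where F: "finite F" "UNIV \<subseteq> (\<Union>x\<in>F. V x)"
    using compactE_image[OF assms, of UNIV V] by metis
  have "closed (K x)" for x
    unfolding K_def by (intro closed_Collect_le continuous_intros continuous_on_char)
  then have "compact (K x)" for x
    using compact_Int_closed[OF assms, of "K x"] by simp
  then have "open (\<Inter>x\<in>F. N x)"
    using F(1) unfolding N_def by (intro open_INT ballI open_dual_basic) auto
  moreover have "\<eta> \<in> (\<Inter>x\<in>F. N x)"
    by (auto simp: N_def K_def)
  moreover have "\<xi> = \<eta>" if \<xi>: "\<xi> \<in> (\<Inter>x\<in>F. N x)" for \<xi>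
  proof -
    have "norm (char_of (\<xi> * inverse \<eta>) y - 1) < 1" for y
    proof -
      have "y \<in> (\<Union>x\<in>F. V x)" using F(2) by (rule subsetD) simp
      then obtain x where x: "x \<in> F" "y \<in> V x" by (rule UN_E)
      have "char_of \<xi> ` K x \<subseteq> ball (char_of \<eta> x) (2 / 3)" "y \<in> K x"
        using \<xi> x by (simp_all add: N_def K_def V_def)
      then have "dist (char_of \<eta> x) (char_of \<xi> y) < 2 / 3"
        by (simp add: image_subset_iff)
      moreover have "dist (char_of \<eta> x) (char_of \<eta> y) < 1 / 3"
        using x by (simp add: V_def)
      ultimately have "dist (char_of \<xi> y) (char_of \<eta> y) < 1"
        using dist_triangle3[of "char_of \<xi> y" "char_of \<eta> y" "char_of \<eta> x"] by linarith
      moreover have "char_of (\<xi> * inverse \<eta>) y - 1 = (char_of \<xi> y - char_of \<eta> y) / char_of \<eta> y"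
        by (simp add: times_dual.rep_eq inverse_dual.rep_eq field_simps)
      ultimately show ?thesis
        by (simp add: norm_divide dist_norm)
    qed
    then have "\<xi> * inverse \<eta> = 1" by (rule char_near_1)
    then show ?thesis
      by (metis dual.left_inverse mult.assoc mult.left_neutral mult.commute)
  qed
  ultimately show "\<exists>T. open T \<and> \<eta> \<in> T \<and> T \<subseteq> S"
    using \<open>\<eta> \<in> S\<close> by blast
qed

definition invariant_pseudometric :: "('a::times \<Rightarrow> 'a \<Rightarrow> real) \<Rightarrow> bool" where
  "invariant_pseudometric p \<longleftrightarrow>
    (\<forall>\<xi> \<eta>. 0 \<le> p \<xi> \<eta>) \<and> (\<forall>\<xi>. p \<xi> \<xi> = 0) \<and> (\<forall>\<xi> \<eta>. p \<xi> \<eta> = p \<eta> \<xi>) \<and>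
    (\<forall>\<xi> \<eta> \<zeta>. p \<xi> \<zeta> \<le> p \<xi> \<eta> + p \<eta> \<zeta>) \<and>
    (\<forall>\<xi> \<eta> \<zeta>. p (\<zeta> * \<xi>) (\<zeta> * \<eta>) = p \<xi> \<eta>)"


section \<open>The space \<open>L\<^sup>2\<close> for the counting measure\<close>

text \<open>All functions are measurable and all nonempty sets have positive measure for the counting
  measure, so neither a measurability condition nor a quotient is needed.\<close>

typedef 'a l2 = "{f :: 'a \<Rightarrow> complex. integrable (count_space UNIV) (\<lambda>\<xi>. (norm (f \<xi>))\<^sup>2)}"
  morphisms l2_fun Abs_l2
  by (rule exI[of _ "\<lambda>_. 0"]) simp

setup_lifting type_definition_l2

lemma integrable_l2_fun: "integrable (count_space UNIV) (\<lambda>\<xi>. (norm (l2_fun f \<xi>))\<^sup>2)"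
  using l2_fun[of f] by simp

lemma square_integrable_add:
  fixes f g :: "'a \<Rightarrow> complex"
  assumes "integrable (count_space UNIV) (\<lambda>\<xi>. (norm (f \<xi>))\<^sup>2)"
    and "integrable (count_space UNIV) (\<lambda>\<xi>. (norm (g \<xi>))\<^sup>2)"
  shows "integrable (count_space UNIV) (\<lambda>\<xi>. (norm (f \<xi> + g \<xi>))\<^sup>2)"
proof (rule Bochner_Integration.integrable_bound)
  show "integrable (count_space UNIV) (\<lambda>\<xi>. 2 * (norm (f \<xi>))\<^sup>2 + 2 * (norm (g \<xi>))\<^sup>2)"
    using assms by simp
  have "(norm (a + b))\<^sup>2 \<le> 2 * (norm a)\<^sup>2 + 2 * (norm b)\<^sup>2" for a b :: complex
  proof -
    have "(norm (a + b))\<^sup>2 \<le> (norm a + norm b)\<^sup>2"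
      by (simp add: norm_triangle_ineq power_mono)
    also have "\<dots> \<le> 2 * (norm a)\<^sup>2 + 2 * (norm b)\<^sup>2"
      using zero_le_power2[of "norm a - norm b"] by (simp add: power2_sum power2_diff)
    finally show ?thesis .
  qed
  then show "AE \<xi> in count_space UNIV. norm ((norm (f \<xi> + g \<xi>))\<^sup>2)
      \<le> norm (2 * (norm (f \<xi>))\<^sup>2 + 2 * (norm (g \<xi>))\<^sup>2)"
    by simp
qed simp

lemma integrable_l2_inner:
  "integrable (count_space UNIV) (\<lambda>\<xi>. inner (l2_fun f \<xi>) (l2_fun g \<xi>))"
proof (rule Bochner_Integration.integrable_bound)
  show "integrable (count_space UNIV) (\<lambda>\<xi>. (norm (l2_fun f \<xi>))\<^sup>2 + (norm (l2_fun g \<xi>))\<^sup>2)"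
    by (simp add: integrable_l2_fun)
  have "\<bar>inner a b\<bar> \<le> (norm a)\<^sup>2 + (norm b)\<^sup>2" for a b :: complex
  proof -
    have "\<bar>inner a b\<bar> \<le> norm a * norm b" by (rule Cauchy_Schwarz_ineq2)
    also have "\<dots> \<le> (norm a)\<^sup>2 + (norm b)\<^sup>2"
      using sum_squares_bound[of "norm a" "norm b"] mult_nonneg_nonneg[OF norm_ge_zero[of a] norm_ge_zero[of b]]
      by linarith
    finally show ?thesis .
  qed
  then show "AE \<xi> in count_space UNIV. norm (inner (l2_fun f \<xi>) (l2_fun g \<xi>))
      \<le> norm ((norm (l2_fun f \<xi>))\<^sup>2 + (norm (l2_fun g \<xi>))\<^sup>2)"
    by simp
qed simp

text \<open>On \<open>complex\<close>, \<open>inner a b = Re (a * cnj b)\<close>, so \<open>inner\<close> below is the real part of the usual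
  sesquilinear inner product; it induces the same norm.\<close>

instantiation l2 :: (type) real_inner
begin

lift_definition zero_l2 :: "'a l2" is "\<lambda>_. 0"
  by simp

lift_definition plus_l2 :: "'a l2 \<Rightarrow> 'a l2 \<Rightarrow> 'a l2" is "\<lambda>f g \<xi>. f \<xi> + g \<xi>"
  by (rule square_integrable_add)

lift_definition uminus_l2 :: "'a l2 \<Rightarrow> 'a l2" is "\<lambda>f \<xi>. - f \<xi>"
  by simp

lift_definition scaleR_l2 :: "real \<Rightarrow> 'a l2 \<Rightarrow> 'a l2" is "\<lambda>c f \<xi>. c *\<^sub>R f \<xi>"
  by (simp add: power_mult_distrib)

definition minus_l2 :: "'a l2 \<Rightarrow> 'a l2 \<Rightarrow> 'a l2"
  where "minus_l2 f g = f + - g"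

definition inner_l2 :: "'a l2 \<Rightarrow> 'a l2 \<Rightarrow> real"
  where "inner_l2 f g = (\<integral>\<xi>. inner (l2_fun f \<xi>) (l2_fun g \<xi>) \<partial>count_space UNIV)"

definition norm_l2 :: "'a l2 \<Rightarrow> real"
  where "norm_l2 f = sqrt (\<integral>\<xi>. (norm (l2_fun f \<xi>))\<^sup>2 \<partial>count_space UNIV)"

definition sgn_l2 :: "'a l2 \<Rightarrow> 'a l2"
  where "sgn_l2 f = inverse (norm f) *\<^sub>R f"

definition dist_l2 :: "'a l2 \<Rightarrow> 'a l2 \<Rightarrow> real"
  where "dist_l2 f g = norm (f - g)"

definition uniformity_l2 :: "('a l2 \<times> 'a l2) filter"
  where "uniformity_l2 = (INF e\<in>{0<..}. principal {(f, g). dist f g < e})"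

definition open_l2 :: "'a l2 set \<Rightarrow> bool"
  where "open_l2 U \<longleftrightarrow> (\<forall>f\<in>U. eventually (\<lambda>(f', g). f' = f \<longrightarrow> g \<in> U) uniformity)"

instance
proof
  fix f g h :: "'a l2" and a b :: real and U :: "'a l2 set"
  show "f + g + h = f + (g + h)" "f + g = g + f" "0 + f = f" "- f + f = 0"
    by (transfer; simp add: fun_eq_iff)+
  show "f - g = f + - g" by (rule minus_l2_def)
  show "a *\<^sub>R (f + g) = a *\<^sub>R f + a *\<^sub>R g" "(a + b) *\<^sub>R f = a *\<^sub>R f + b *\<^sub>R f"
    "a *\<^sub>R b *\<^sub>R f = (a * b) *\<^sub>R f" "1 *\<^sub>R f = f"
    by (transfer; simp add: fun_eq_iff algebra_simps)+
  show "sgn f = inverse (norm f) *\<^sub>R f" by (rule sgn_l2_def)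
  show "dist f g = norm (f - g)" by (rule dist_l2_def)
  show "(uniformity :: ('a l2 \<times> 'a l2) filter) = (INF e\<in>{0<..}. principal {(x, y). dist x y < e})"
    by (rule uniformity_l2_def)
  show "open U \<longleftrightarrow> (\<forall>x\<in>U. \<forall>\<^sub>F (x', y) in uniformity. x' = x \<longrightarrow> y \<in> U)"
    by (rule open_l2_def)
  show "inner f g = inner g f"
    by (simp add: inner_l2_def inner_commute)
  show "inner (f + g) h = inner f h + inner g h"
    by (simp add: inner_l2_def plus_l2.rep_eq inner_add_left integrable_l2_inner)
  show "inner (a *\<^sub>R f) g = a * inner f g"
    by (simp add: inner_l2_def scaleR_l2.rep_eq)
  show "0 \<le> inner f f"
    by (simp add: inner_l2_def)
  show "inner f f = 0 \<longleftrightarrow> f = 0"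
    using integrable_l2_inner[of f f]
    by (simp add: inner_l2_def integral_nonneg_eq_0_iff_AE AE_count_space
        l2_fun_inject[symmetric] zero_l2.rep_eq fun_eq_iff)
  show "norm f = sqrt (inner f f)"
    by (simp add: norm_l2_def inner_l2_def power2_norm_eq_inner)
qed

end

lift_definition damping_operator :: "('a \<Rightarrow> real) \<Rightarrow> 'a l2 \<Rightarrow> 'a l2" is
  "\<lambda>\<gamma> f \<xi>. f \<xi> / of_real (sqrt (1 + (\<gamma> \<xi>)\<^sup>2))"
proof -
  fix \<gamma> :: "'a \<Rightarrow> real" and f :: "'a \<Rightarrow> complex"
  assume "integrable (count_space UNIV) (\<lambda>\<xi>. (norm (f \<xi>))\<^sup>2)"
  then show "integrable (count_space UNIV)
      (\<lambda>\<xi>. (norm (f \<xi> / of_real (sqrt (1 + (\<gamma> \<xi>)\<^sup>2))))\<^sup>2)"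
  proof (rule Bochner_Integration.integrable_bound)
    have "norm (f \<xi> / of_real (sqrt (1 + (\<gamma> \<xi>)\<^sup>2))) \<le> norm (f \<xi>)" for \<xi>
    proof -
      have "1 \<le> sqrt (1 + (\<gamma> \<xi>)\<^sup>2)" by simp
      then have "norm (f \<xi>) / sqrt (1 + (\<gamma> \<xi>)\<^sup>2) \<le> norm (f \<xi>) / 1"
        by (intro divide_left_mono) (auto simp: add_pos_nonneg)
      then show ?thesis by (simp add: norm_divide)
    qed
    then show "AE \<xi> in count_space UNIV. norm ((norm (f \<xi> / of_real (sqrt (1 + (\<gamma> \<xi>)\<^sup>2))))\<^sup>2)
        \<le> norm ((norm (f \<xi>))\<^sup>2)"
      by (intro AE_I2) (simp add: power_mono)
  qed simp
qed

text \<open>For an operator between complex spaces only real linearity is demanded;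
  complex linearity of \<^const>\<open>damping_operator\<close> is evident from its formula.\<close>

definition compact_operator :: "('a::real_normed_vector \<Rightarrow> 'b::real_normed_vector) \<Rightarrow> bool" where
  "compact_operator T \<longleftrightarrow> linear T \<and> (\<forall>B. bounded B \<longrightarrow> compact (closure (T ` B)))"

end

theory Submission
  imports Defs
begin

text \<open>The damping operator is diagonal in the orthonormal basis of point masses: it multiplies the
  point mass at \<open>\<xi>\<close> by \<open>1 / sqrt (1 + \<gamma> \<xi> ^ 2)\<close>. A compact diagonal operator has
  only finitely many diagonal entries of modulus at least a given \<open>e > 0\<close>, because the images
  of the corresponding point masses form an \<open>e\<close>-separated subset of a compact set. On a sublevel
  set \<open>{\<xi>. \<bar>\<gamma> \<xi>\<bar> \<le> c}\<close> the entries are bounded below by \<open>1 / sqrt (1 + c ^ 2)\<close>, so every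
  sublevel set is finite (\<open>finite_sublevel_if_compact_damping\<close>), and the whole space is the
  union of the sublevel sets for \<open>c = 0, 1, 2, \<dots>\<close>.\<close>

lift_definition point_mass :: "'a \<Rightarrow> 'a l2" is "\<lambda>\<xi> \<eta>. indicator {\<xi>} \<eta>"
proof -
  fix \<xi> :: 'a
  have "(\<lambda>\<eta>. (norm (indicator {\<xi>} \<eta> :: complex))\<^sup>2) = (indicator {\<xi>} :: 'a \<Rightarrow> real)"
    by (auto simp: fun_eq_iff indicator_def)
  then show "integrable (count_space UNIV) (\<lambda>\<eta>. (norm (indicator {\<xi>} \<eta> :: complex))\<^sup>2)"
    by simp
qed

lemma norm_point_mass: "norm (point_mass \<xi>) = 1"
proof -
  have "(\<lambda>\<eta>. (norm (l2_fun (point_mass \<xi>) \<eta>))\<^sup>2) = indicator {\<xi>}"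
    by (auto simp: fun_eq_iff point_mass.rep_eq indicator_def)
  then show ?thesis
    by (simp add: norm_l2_def)
qed

text \<open>A single term of the sum of squares is at most the whole sum. Distances in
  \<open>L\<^sup>2\<close> can thus be bounded below by looking at one point.\<close>

lemma norm_l2_fun_le: "norm (l2_fun f \<xi>) \<le> norm f"
proof -
  have "(norm (l2_fun f \<xi>))\<^sup>2
      = (\<integral>\<eta>. indicator {\<xi>} \<eta> * (norm (l2_fun f \<xi>))\<^sup>2 \<partial>count_space UNIV)"
    by simp
  also have "\<dots> \<le> (\<integral>\<eta>. (norm (l2_fun f \<eta>))\<^sup>2 \<partial>count_space UNIV)"
  proof (intro integral_mono integrable_l2_fun)
    show "integrable (count_space UNIV) (\<lambda>\<eta>. indicator {\<xi>} \<eta> * (norm (l2_fun f \<xi>))\<^sup>2)"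
      by simp
  qed (auto simp: indicator_def)
  finally show ?thesis
    unfolding norm_l2_def by (rule real_le_rsqrt)
qed

lemma l2_fun_diff: "l2_fun (f - g) \<xi> = l2_fun f \<xi> - l2_fun g \<xi>"
  unfolding minus_l2_def plus_l2.rep_eq uminus_l2.rep_eq by simp

text \<open>The value of the difference at \<open>\<xi>\<close> is the diagonal entry at \<open>\<xi>\<close>, since the second point
  mass vanishes there.\<close>

lemma dist_damped_point_masses:
  assumes "\<eta> \<noteq> \<xi>" and "\<bar>\<gamma> \<xi>\<bar> \<le> c"
  shows "1 / sqrt (1 + c\<^sup>2)
    \<le> dist (damping_operator \<gamma> (point_mass \<xi>)) (damping_operator \<gamma> (point_mass \<eta>))"
proof -
  let ?f = "damping_operator \<gamma> (point_mass \<xi>) - damping_operator \<gamma> (point_mass \<eta>)"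
  have "(\<gamma> \<xi>)\<^sup>2 \<le> c\<^sup>2"
    using power_mono[OF assms(2), of 2] by simp
  then have "1 / sqrt (1 + c\<^sup>2) \<le> 1 / sqrt (1 + (\<gamma> \<xi>)\<^sup>2)"
    by (intro divide_left_mono) (auto simp: add_pos_nonneg)
  also have "\<dots> = norm (l2_fun ?f \<xi>)"
    using assms(1) by (simp add: l2_fun_diff damping_operator.rep_eq point_mass.rep_eq
        norm_divide)
  also have "\<dots> \<le> norm ?f"
    by (rule norm_l2_fun_le)
  finally show ?thesis
    by (simp add: dist_norm)
qed

text \<open>The damped point masses over an infinite sublevel set would form an infinite
  subset of a compact set and so have an accumulation point, which a uniformly separated set
  cannot have.\<close>

lemma finite_sublevel_if_compact_damping:
  fixes \<gamma> :: "'a \<Rightarrow> real"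
  assumes "compact_operator (damping_operator \<gamma>)"
  shows "finite {\<xi>. \<bar>\<gamma> \<xi>\<bar> \<le> c}"
proof (rule ccontr)
  define S where "S = {\<xi>. \<bar>\<gamma> \<xi>\<bar> \<le> c}"
  define v where "v = (\<lambda>\<xi>. damping_operator \<gamma> (point_mass \<xi>))"
  define e where "e = 1 / sqrt (1 + c\<^sup>2)"
  assume "infinite {\<xi>. \<bar>\<gamma> \<xi>\<bar> \<le> c}"
  then have "infinite S"
    by (simp add: S_def)
  have "e > 0"
    by (simp add: e_def add_pos_nonneg)
  have separated: "\<eta> = \<xi>" if "\<xi> \<in> S" "dist (v \<eta>) (v \<xi>) < e" for \<xi> \<eta>
    using dist_damped_point_masses[of \<eta> \<xi> \<gamma> c] that
    by (force simp: S_def v_def e_def dist_commute)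
  then have "inj_on v S"
    using \<open>e > 0\<close> by (intro inj_onI) (metis dist_self)
  then have "infinite (v ` S)"
    using \<open>infinite S\<close> by (simp add: finite_image_iff)
  have "bounded (point_mass ` S)"
    by (auto simp: bounded_iff norm_point_mass)
  then have "compact (closure (damping_operator \<gamma> ` point_mass ` S))"
    using assms unfolding compact_operator_def by blast
  then have "compact (closure (v ` S))"
    unfolding v_def image_image .
  then obtain l where "l islimpt v ` S"
    by (rule Heine_Borel_imp_Bolzano_Weierstrass[OF _ \<open>infinite (v ` S)\<close> closure_subset, THEN bexE])
  moreover have "\<not> l islimpt v ` S"
    by (rule discrete_imp_not_islimpt[OF \<open>e > 0\<close>]) (auto dest: separated)
  ultimately show False
    by blast
qed

theorem theorem4p3:
  fixes p :: "'g::{topological_ab_group_add, t2_space} dual \<Rightarrow> 'g dual \<Rightarrow> real"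
    and \<gamma> :: "'g dual \<Rightarrow> real"
  assumes "compact (UNIV :: 'g set)"
    and "invariant_pseudometric p"
    and "continuous_on UNIV (\<lambda>(\<xi>, \<eta>). p \<xi> \<eta>)"
    and "\<And>\<xi>. \<gamma> \<xi> = p \<xi> 1"
    and "compact_operator (damping_operator \<gamma> :: 'g dual l2 \<Rightarrow> 'g dual l2)"
  shows "countable (UNIV :: 'g dual set)"
proof -
  have "(UNIV :: 'g dual set) = (\<Union>n. {\<xi>. \<bar>\<gamma> \<xi>\<bar> \<le> real n})"
    by (auto intro: real_arch_simple)
  moreover have "countable (\<Union>n. {\<xi>. \<bar>\<gamma> \<xi>\<bar> \<le> real n})"
    using finite_sublevel_if_compact_damping[OF assms(5)]
    by (intro countable_UN) (auto intro: countable_finite)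
  ultimately show ?thesis
    by simp
qed

end
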